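(* Let $\mathscr T=(V,E)$ be a rooted directed tree with root $\mathsf{root}$. For $u,b\in V$, consider a weight system $\lambda_u=\{\lambda_{uv}\}$ of complex numbers and let $W_{f,g}$ be the rank one extension of the weighted join operator $W^{(b)}_{\lambda_u}$ on $\mathscr T$, where $f\in\ell^2(V)\ominus\mathscr H$ is non-zero and $g:U\to\mathbb C$ is given ($U$, $\mathscr H=\ell^2(U)$, $D$, $\Gamma_{\lambda_u}$, $W_{f,g}$ and the compatibility conditions I and II are defined in the context). If $W_{f,g}$ satisfies a compatibility condition, then $\mathscr D(D)\subseteq\mathscr D(f\oslash g)$. Moreover, if $\Gamma_{\lambda_u}$ is non-empty, then the following statements are equivalent: (i) $\mathscr D(D)\subseteq\mathscr D(f\oslash g)$. (ii) $W_{f,g}$ satisfies compatibility condition I. (iii) The discrete Hilbert transform $H_{\lambda_u,g}$ given by $$H_{\lambda_u,g}(h)=\sum_{v\in U}\frac{h(v)\overline{g(v)}}{\mu-\lambda_{uv}}$$ is well-defined for every $\mu\in\Gamma_{\lambda_u}$ and every $h\in\mathscr H$. (iv) For every $\mu\in\Gamma_{\lambda_u}$, the linear operator $L_{\lambda_u,\mu}:=(f\oslash g)(D-\mu)^{-1}$ defines a bounded linear transformation from $\mathscr H$ into $\ell^2(V)\ominus\mathscr H$.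
   Context: Trees. A directed tree $\mathscr T=(V,E)$ is a directed graph (no loops, $V$ and $E$ nonempty) which has no circuits, is connected (ignoring orientation), and in which every non-root vertex $v$ has exactly one parent $\mathsf{par}(v)$; it is rooted if there is a unique vertex $\mathsf{root}$ without parent. Throughout $\mathrm{card}(V)=\aleph_0$. $\mathsf{Des}(u)$ is the set of descendants of $u$, including $u$; $\mathsf{Asc}(u)=\{\mathsf{par}^{\langle n\rangle}(u):n\ge1\}$; for $v\in\mathsf{Des}(u)$, $[u,v]$ is the set of vertices of the directed path from $u$ to $v$ and $\mathsf{Des}_v(u)=\mathsf{Des}(u)\setminus[u,v]$. Rank one extension. Let $u,b\in V$ and $\{\lambda_{uv}\}_{v\in V}\subseteq\mathbb C$. Put $U=V\setminus\{u\}$ if $b=u$; $U=\mathsf{Asc}(u)\cup\mathsf{Des}_b(u)$ if $b\in\mathsf{Des}(u)\setminus\{u\}$; $U=\mathsf{Des}(u)\setminus\{u\}$ if $b\notin\mathsf{Des}(u)$. Put $A_u=[u,b]$ if $b\in\mathsf{Des}(u)$ and $A_u=\mathsf{Asc}(u)\cup\{b,u\}$ otherwise. $\mathscr H=\mathscr H^{(b)}_u=\ell^2(U)\subseteq\ell^2(V)$ (so $U=\mathrm{supp}\,\mathscr H$). $D=D^{(b)}_{\lambda_u}$ is the maximally defined diagonal operator in $\mathscr H$ with $De_v=\lambda_{uv}e_v$ ($v\in U$), and $N=N^{(b)}_{\lambda_u}=e_u\otimes e_{\lambda_u,A_u}$ on $\ell^2(V)\ominus\mathscr H$, with $e_{\lambda_u,A_u}=\sum_{v\in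 A_u}\overline{\lambda_{uv}}e_v$ and $(x\otimes y)h=\langle h,y\rangle x$. (The weighted join operator is $W^{(b)}_{\lambda_u}=D\oplus N$.) The operator $f\oslash g$ has domain $\{h\in\mathscr H:\sum_{v\in U}h(v)\overline{g(v)}\text{ is convergent}\}$ and $(f\oslash g)h=\big(\sum_{v\in U}h(v)\overline{g(v)}\big)f$. The rank one extension $W_{f,g}$ is the operator in $\ell^2(V)$ with domain $\{(h,k):h\in\mathscr D(D)\cap\mathscr D(f\oslash g),\ k\in\ell^2(V)\ominus\mathscr H\}$ and $W_{f,g}=\begin{bmatrix}D&0\\ f\oslash g&N\end{bmatrix}$. Compatibility. $\Gamma_{\lambda_u}=\{\mu\in\mathbb C:\inf_{v\in U}|\mu-\lambda_{uv}|>0\}$. Compatibility condition I: there is $\mu_0\in\Gamma_{\lambda_u}$ with $\sum_{v\in U}\frac{|g(v)|^2}{|\lambda_{uv}-\mu_0|^2}<\infty$. Compatibility condition II: $\sum_{v\in U}\frac{|g(v)|^2}{|\lambda_{uv}|^2+1}<\infty$. "Satisfies a compatibility condition" means that I or II holds. *)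

theory Defs
  imports "HOL-Analysis.Analysis"
begin

section \<open>Directed trees\<close>

definition is_root :: "'a set \<Rightarrow> ('a \<times> 'a) set \<Rightarrow> 'a \<Rightarrow> bool" where
  "is_root V E v \<longleftrightarrow> v \<in> V \<and> (\<forall>w. (w, v) \<notin> E)"

definition directed_tree :: "'a set \<Rightarrow> ('a \<times> 'a) set \<Rightarrow> bool" where
  "directed_tree V E \<longleftrightarrow>
     V \<noteq> {} \<and> E \<noteq> {} \<and> E \<subseteq> V \<times> V \<and> irrefl E \<and> acyclic E \<and>
     (\<forall>x\<in>V. \<forall>y\<in>V. (x, y) \<in> (E \<union> E\<inverse>)\<^sup>*) \<and>
     (\<forall>v\<in>V. \<not> is_root V E v \<longrightarrow> (\<exists>!w. (w, v) \<in> E))"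

definition rooted_directed_tree :: "'a set \<Rightarrow> ('a \<times> 'a) set \<Rightarrow> bool" where
  "rooted_directed_tree V E \<longleftrightarrow>
     directed_tree V E \<and> (\<exists>!r. is_root V E r) \<and> infinite V \<and> countable V"

definition Des :: "('a \<times> 'a) set \<Rightarrow> 'a \<Rightarrow> 'a set" where
  "Des E u = {v. (u, v) \<in> E\<^sup>*}"

text \<open>The parent is a partial function, undefined at the root; its \<open>n\<close>-th iterate at \<open>u\<close>
  is the vertex \<open>w\<close> with \<open>(w, u) \<in> E ^^ n\<close>, if there is one.\<close>

definition Asc :: "('a \<times> 'a) set \<Rightarrow> 'a \<Rightarrow> 'a set" where
  "Asc E u = {w. \<exists>n\<ge>1. (w, u) \<in> E ^^ n}"

definition directed_path :: "('a \<times> 'a) set \<Rightarrow> 'a \<Rightarrow> 'a list \<Rightarrow> 'a \<Rightarrow> bool" where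
  "directed_path E u p v \<longleftrightarrow>
     p \<noteq> [] \<and> hd p = u \<and> last p = v \<and> successively (\<lambda>x y. (x, y) \<in> E) p"

text \<open>Meaningful only for \<open>v \<in> Des E u\<close>; the path is then unique in a directed tree.\<close>

definition segment :: "('a \<times> 'a) set \<Rightarrow> 'a \<Rightarrow> 'a \<Rightarrow> 'a set" where
  "segment E u v = set (THE p. directed_path E u p v)"

definition Des_off :: "('a \<times> 'a) set \<Rightarrow> 'a \<Rightarrow> 'a \<Rightarrow> 'a set" where
  "Des_off E v u = Des E u - segment E u v"

definition supp_set :: "'a set \<Rightarrow> ('a \<times> 'a) set \<Rightarrow> 'a \<Rightarrow> 'a \<Rightarrow> 'a set" where
  "supp_set V E u b =
     (if b = u then V - {u}
      else if b \<in> Des E u then Asc E u \<union> Des_off E b u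
      else Des E u - {u})"

definition join_set :: "('a \<times> 'a) set \<Rightarrow> 'a \<Rightarrow> 'a \<Rightarrow> 'a set" where
  "join_set E u b = (if b \<in> Des E u then segment E u b else Asc E u \<union> {b, u})"


section \<open>Square-summable functions and unbounded operators\<close>

text \<open>Elements of \<open>\<ell>\<^sup>2(S)\<close> are functions on the whole type vanishing off \<open>S\<close>, so that
  \<open>\<ell>\<^sup>2(U)\<close> is literally a subset of \<open>\<ell>\<^sup>2(V)\<close> for \<open>U \<subseteq> V\<close>, and inner products and norms
  may be summed over the whole type.\<close>

definition l2 :: "'a set \<Rightarrow> ('a \<Rightarrow> complex) set" where
  "l2 S = {h. (\<forall>v. v \<notin> S \<longrightarrow> h v = 0) \<and> (\<lambda>v. (cmod (h v))\<^sup>2) summable_on S}"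

definition l2_inner :: "('a \<Rightarrow> complex) \<Rightarrow> ('a \<Rightarrow> complex) \<Rightarrow> complex" where
  "l2_inner h k = (\<Sum>\<^sub>\<infinity>v. h v * cnj (k v))"

definition l2_norm :: "('a \<Rightarrow> complex) \<Rightarrow> real" where
  "l2_norm h = sqrt (\<Sum>\<^sub>\<infinity>v. (cmod (h v))\<^sup>2)"

definition l2_ominus ::
    "('a \<Rightarrow> complex) set \<Rightarrow> ('a \<Rightarrow> complex) set \<Rightarrow> ('a \<Rightarrow> complex) set" where
  "l2_ominus K H = {k \<in> K. \<forall>h\<in>H. l2_inner k h = 0}"

text \<open>A possibly unbounded, not everywhere defined operator is represented by its graph.
  Thus \<open>Domain T\<close> is its domain, \<open>T\<inverse>\<close> its inverse, and \<open>S O T\<close> is the operator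
  ``first \<open>S\<close>, then \<open>T\<close>''.\<close>

type_synonym 'a l2_op = "(('a \<Rightarrow> complex) \<times> ('a \<Rightarrow> complex)) set"

definition op_minus_scalar :: "'a l2_op \<Rightarrow> complex \<Rightarrow> 'a l2_op" where
  "op_minus_scalar T \<mu> = {(h, \<lambda>v. k v - \<mu> * h v) | h k. (h, k) \<in> T}"

definition bounded_linear_transformation ::
    "'a l2_op \<Rightarrow> ('a \<Rightarrow> complex) set \<Rightarrow> ('a \<Rightarrow> complex) set \<Rightarrow> bool" where
  "bounded_linear_transformation T X Y \<longleftrightarrow>
     single_valued T \<and> Domain T = X \<and> Range T \<subseteq> Y \<and>
     (\<forall>h k h' k' \<alpha> \<beta>. (h, k) \<in> T \<longrightarrow> (h', k') \<in> T \<longrightarrow>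
        (\<lambda>v. \<alpha> * h v + \<beta> * h' v, \<lambda>v. \<alpha> * k v + \<beta> * k' v) \<in> T) \<and>
     (\<exists>C. \<forall>h k. (h, k) \<in> T \<longrightarrow> l2_norm k \<le> C * l2_norm h)"


section \<open>The rank one extension of a weighted join operator\<close>

text \<open>The weight system is a function \<open>lam\<close> of \<open>v\<close> alone, \<open>u\<close> being fixed.\<close>

definition join_space :: "'a set \<Rightarrow> ('a \<times> 'a) set \<Rightarrow> 'a \<Rightarrow> 'a \<Rightarrow> ('a \<Rightarrow> complex) set" where
  "join_space V E u b = l2 (supp_set V E u b)"

definition join_compl :: "'a set \<Rightarrow> ('a \<times> 'a) set \<Rightarrow> 'a \<Rightarrow> 'a \<Rightarrow> ('a \<Rightarrow> complex) set" where
  "join_compl V E u b = l2_ominus (l2 V) (join_space V E u b)"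

definition diag_op ::
    "'a set \<Rightarrow> ('a \<times> 'a) set \<Rightarrow> 'a \<Rightarrow> 'a \<Rightarrow> ('a \<Rightarrow> complex) \<Rightarrow> 'a l2_op" where
  "diag_op V E u b lam =
     {(h, \<lambda>v. lam v * h v) | h.
        h \<in> join_space V E u b \<and> (\<lambda>v. lam v * h v) \<in> join_space V E u b}"

definition basis_vec :: "'a \<Rightarrow> 'a \<Rightarrow> complex" where
  "basis_vec u = (\<lambda>v. if v = u then 1 else 0)"

definition join_vec :: "('a \<times> 'a) set \<Rightarrow> 'a \<Rightarrow> 'a \<Rightarrow> ('a \<Rightarrow> complex) \<Rightarrow> 'a \<Rightarrow> complex" where
  "join_vec E u b lam = (\<lambda>v. if v \<in> join_set E u b then cnj (lam v) else 0)"

definition join_rank_one_op ::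
    "'a set \<Rightarrow> ('a \<times> 'a) set \<Rightarrow> 'a \<Rightarrow> 'a \<Rightarrow> ('a \<Rightarrow> complex) \<Rightarrow> 'a l2_op" where
  "join_rank_one_op V E u b lam =
     {(k, \<lambda>v. l2_inner k (join_vec E u b lam) * basis_vec u v) | k. k \<in> join_compl V E u b}"

text \<open>The operator \<open>f \<oslash> g\<close>. As \<open>U\<close> carries no order, convergence of the series is
  unconditional convergence.\<close>

definition oslash_op ::
    "'a set \<Rightarrow> ('a \<times> 'a) set \<Rightarrow> 'a \<Rightarrow> 'a \<Rightarrow> ('a \<Rightarrow> complex) \<Rightarrow> ('a \<Rightarrow> complex) \<Rightarrow> 'a l2_op" where
  "oslash_op V E u b f g =
     {(h, \<lambda>v. (\<Sum>\<^sub>\<infinity>w\<in>supp_set V E u b. h w * cnj (g w)) * f v) | h.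
        h \<in> join_space V E u b \<and> (\<lambda>w. h w * cnj (g w)) summable_on supp_set V E u b}"

text \<open>The pair \<open>(h, k)\<close> of the orthogonal decomposition is identified with \<open>h + k\<close>.\<close>

definition rank_one_ext ::
    "'a set \<Rightarrow> ('a \<times> 'a) set \<Rightarrow> 'a \<Rightarrow> 'a \<Rightarrow> ('a \<Rightarrow> complex) \<Rightarrow>
     ('a \<Rightarrow> complex) \<Rightarrow> ('a \<Rightarrow> complex) \<Rightarrow> 'a l2_op" where
  "rank_one_ext V E u b lam f g =
     {(\<lambda>v. h v + k v, \<lambda>v. x v + (y v + z v)) | h k x y z.
        (h, x) \<in> diag_op V E u b lam \<and> (h, y) \<in> oslash_op V E u b f g \<and>
        (k, z) \<in> join_rank_one_op V E u b lam}"

text \<open>The infimum is taken in the extended reals, where it is infinite for empty \<open>U\<close>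
  (which happens when \<open>u\<close> is a leaf and \<open>b \<noteq> u\<close>).\<close>

definition Gamma_set ::
    "'a set \<Rightarrow> ('a \<times> 'a) set \<Rightarrow> 'a \<Rightarrow> 'a \<Rightarrow> ('a \<Rightarrow> complex) \<Rightarrow> complex set" where
  "Gamma_set V E u b lam =
     {\<mu>. (INF v\<in>supp_set V E u b. ereal (cmod (\<mu> - lam v))) > 0}"

text \<open>The compatibility conditions depend on the data defining the rank one extension, not on its
  graph alone; hence \<open>rank_one_ext\<close> itself is not an argument.\<close>

definition compat_I ::
    "'a set \<Rightarrow> ('a \<times> 'a) set \<Rightarrow> 'a \<Rightarrow> 'a \<Rightarrow> ('a \<Rightarrow> complex) \<Rightarrow> ('a \<Rightarrow> complex) \<Rightarrow> bool" where
  "compat_I V E u b lam g \<longleftrightarrow>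
     (\<exists>\<mu>\<^sub>0\<in>Gamma_set V E u b lam.
        (\<lambda>v. (cmod (g v))\<^sup>2 / (cmod (lam v - \<mu>\<^sub>0))\<^sup>2) summable_on supp_set V E u b)"

definition compat_II ::
    "'a set \<Rightarrow> ('a \<times> 'a) set \<Rightarrow> 'a \<Rightarrow> 'a \<Rightarrow> ('a \<Rightarrow> complex) \<Rightarrow> ('a \<Rightarrow> complex) \<Rightarrow> bool" where
  "compat_II V E u b lam g \<longleftrightarrow>
     (\<lambda>v. (cmod (g v))\<^sup>2 / ((cmod (lam v))\<^sup>2 + 1)) summable_on supp_set V E u b"

text \<open>Well-definedness at \<open>\<mu>\<close> of the discrete Hilbert transform of \<open>h\<close>, i.e. convergence of
  its defining series.\<close>

definition hilbert_transform_defined ::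
    "'a set \<Rightarrow> ('a \<times> 'a) set \<Rightarrow> 'a \<Rightarrow> 'a \<Rightarrow> ('a \<Rightarrow> complex) \<Rightarrow> ('a \<Rightarrow> complex) \<Rightarrow>
     ('a \<Rightarrow> complex) \<Rightarrow> complex \<Rightarrow> bool" where
  "hilbert_transform_defined V E u b lam g h \<mu> \<longleftrightarrow>
     (\<lambda>v. h v * cnj (g v) / (\<mu> - lam v)) summable_on supp_set V E u b"

definition L_op ::
    "'a set \<Rightarrow> ('a \<times> 'a) set \<Rightarrow> 'a \<Rightarrow> 'a \<Rightarrow> ('a \<Rightarrow> complex) \<Rightarrow>
     ('a \<Rightarrow> complex) \<Rightarrow> ('a \<Rightarrow> complex) \<Rightarrow> complex \<Rightarrow> 'a l2_op" where
  "L_op V E u b lam f g \<mu> =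
     (op_minus_scalar (diag_op V E u b lam) \<mu>)\<inverse> O oslash_op V E u b f g"

end

theory Submission
  imports Defs
begin

text \<open>
  Write \<open>U\<close> for the support of \<open>\<H>\<close>. Everything is governed by one condition on a point \<open>\<mu>\<close> at
  positive distance from the weights: that \<open>g / (lam - \<mu>)\<close> be square summable on \<open>U\<close>. For such \<open>\<mu>\<close>
  the domain of \<open>D\<close> consists of the quotients \<open>k / (lam - \<mu>)\<close> with \<open>k \<in> \<ell>\<^sup>2(U)\<close>
  (\<open>op_minus_scalar_diag_op\<close>). Hence the inclusion of domains, the convergence of the discrete
  Hilbert transform at \<open>\<mu>\<close> and the everywhere-definedness of \<open>(f \<oslash> g)(D - \<mu>)\<^sup>-\<^sup>1\<close> all say that the series
  \<open>\<Sum> k * cnj g / (lam - \<mu>)\<close> converges for every \<open>k \<in> \<ell>\<^sup>2(U)\<close>.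

  By Cauchy--Schwarz and its converse (\<open>square_summable_if_all_pairings_summable\<close>), this is
  square summability of \<open>g / (lam - \<mu>)\<close>, see \<open>pairing_with_resolvent_weight\<close>; Cauchy--Schwarz also
  supplies the bound for the operator. The inclusion of domains does not mention \<open>\<mu>\<close>, so it links
  condition I, which asks for one \<open>\<mu>\<close>, to the statements quantified over all \<open>\<mu>\<close>. Condition II
  enters only through the inclusion that it implies, by the same Cauchy--Schwarz argument with
  the weight \<open>sqrt (|lam|\<^sup>2 + 1)\<close> in place of \<open>|lam - \<mu>|\<close>
  (\<open>Domain_diag_op_subset_if_compat\<close>).
\<close>

section \<open>Square summability\<close>

lemma summable_mult_of_squares:
  fixes h a :: "'a \<Rightarrow> complex"
  assumes h: "(\<lambda>v. (cmod (h v))\<^sup>2) summable_on U" and a: "(\<lambda>v. (cmod (a v))\<^sup>2) summable_on U"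
  shows "(\<lambda>v. norm (h v * a v)) summable_on U"
proof (rule summable_on_comparison_test)
  show "(\<lambda>v. (cmod (h v))\<^sup>2 + (cmod (a v))\<^sup>2) summable_on U"
    using h a by (rule summable_on_add)
  show "norm (h v * a v) \<le> (cmod (h v))\<^sup>2 + (cmod (a v))\<^sup>2" for v
  proof -
    have "0 \<le> cmod (h v) * cmod (a v)" by simp
    then show ?thesis
      using sum_squares_bound[of "cmod (h v)" "cmod (a v)"] unfolding norm_mult by linarith
  qed
qed simp

lemma norm_infsum_mult_le:
  fixes h a :: "'a \<Rightarrow> complex"
  assumes h: "(\<lambda>v. (cmod (h v))\<^sup>2) summable_on U" and a: "(\<lambda>v. (cmod (a v))\<^sup>2) summable_on U"
  shows "norm (\<Sum>\<^sub>\<infinity>v\<in>U. h v * a v)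
    \<le> sqrt (\<Sum>\<^sub>\<infinity>v\<in>U. (cmod (h v))\<^sup>2) * sqrt (\<Sum>\<^sub>\<infinity>v\<in>U. (cmod (a v))\<^sup>2)"
proof -
  have abs: "(\<lambda>v. norm (h v * a v)) summable_on U"
    using h a by (rule summable_mult_of_squares)
  have "norm (\<Sum>\<^sub>\<infinity>v\<in>U. h v * a v) \<le> (\<Sum>\<^sub>\<infinity>v\<in>U. norm (h v * a v))"
    using abs by (rule norm_infsum_bound)
  also have "\<dots> \<le> sqrt (\<Sum>\<^sub>\<infinity>v\<in>U. (cmod (h v))\<^sup>2) * sqrt (\<Sum>\<^sub>\<infinity>v\<in>U. (cmod (a v))\<^sup>2)"
  proof (rule infsum_le_finite_sums[OF abs])
    fix F assume F: "finite F" "F \<subseteq> U"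
    have "(\<Sum>v\<in>F. norm (h v * a v)) \<le> L2_set (\<lambda>v. cmod (h v)) F * L2_set (\<lambda>v. cmod (a v)) F"
      using L2_set_mult_ineq[of "\<lambda>v. cmod (h v)" "\<lambda>v. cmod (a v)" F] by (simp add: norm_mult)
    also have "\<dots> \<le> sqrt (\<Sum>\<^sub>\<infinity>v\<in>U. (cmod (h v))\<^sup>2) * sqrt (\<Sum>\<^sub>\<infinity>v\<in>U. (cmod (a v))\<^sup>2)"
      unfolding L2_set_def using F
      by (intro mult_mono real_sqrt_le_mono finite_sum_le_infsum h a)
         (auto intro!: sum_nonneg infsum_nonneg)
    finally show "(\<Sum>v\<in>F. norm (h v * a v)) \<le> \<dots>" .
  qed
  finally show ?thesis .
qed

text \<open>The \<open>\<ell>\<^sup>2\<close> case of Landau's theorem, the converse of the Cauchy--Schwarz inequality. If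
  \<open>\<Sum>|a|\<^sup>2\<close> diverges, there are finite sets \<open>F n\<close> on which its partial sum \<open>S n\<close> is at least
  \<open>4 ^ n\<close>. The densities \<open>|a|\<^sup>2 / S n\<close> on \<open>F n\<close> have total mass 1, so their mixture with
  weights \<open>2 ^ -n\<close> is summable; its square root is an \<open>\<ell>\<^sup>2\<close> sequence which, paired with \<open>|a|\<close>
  over \<open>F n\<close>, gives at least \<open>sqrt (S n / 2 ^ n) \<ge> sqrt (2 ^ n)\<close>. Taking the square root of a
  mixture of squares, rather than a mixture of vectors, makes the norm a plain sum, and the
  \<open>F n\<close> may overlap.\<close>

lemma square_summable_if_all_pairings_summable:
  fixes a :: "'a \<Rightarrow> complex"
  assumes pair: "\<And>h. h \<in> l2 U \<Longrightarrow> (\<lambda>v. h v * a v) summable_on U"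
  shows "(\<lambda>v. (cmod (a v))\<^sup>2) summable_on U"
proof (rule ccontr)
  assume div: "\<not> (\<lambda>v. (cmod (a v))\<^sup>2) summable_on U"
  have "\<exists>F. finite F \<and> F \<subseteq> U \<and> (\<Sum>v\<in>F. (cmod (a v))\<^sup>2) \<ge> 4 ^ n" for n :: nat
  proof (rule ccontr)
    assume "\<not> ?thesis"
    then have "(\<lambda>v. (cmod (a v))\<^sup>2) summable_on U"
      by (intro nonneg_bdd_above_summable_on bdd_aboveI2[where M = "4 ^ n"])
         (auto simp: not_le intro: less_imp_le)
    with div show False ..
  qed
  then obtain F where F: "\<And>n. finite (F n)" "\<And>n. F n \<subseteq> U"
    and large: "\<And>n::nat. 4 ^ n \<le> (\<Sum>v\<in>F n. (cmod (a v))\<^sup>2)"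
    by metis
  define S where "S n = (\<Sum>v\<in>F n. (cmod (a v))\<^sup>2)" for n
  have S4: "4 ^ n \<le> S n" for n using large by (simp add: S_def)
  have Spos: "0 < S n" for n
    by (rule less_le_trans[OF _ S4]) simp
  define d where "d n v = (if v \<in> F n then (cmod (a v))\<^sup>2 / S n else 0)" for n v
  have d0: "0 \<le> d n v" for n v using Spos[of n] by (simp add: d_def)
  have d_mass: "(\<Sum>v\<in>G. d n v) \<le> 1" if "finite G" for G n
  proof -
    have "(\<Sum>v\<in>G. d n v) = (\<Sum>v\<in>G \<inter> F n. (cmod (a v))\<^sup>2 / S n)"
      using that by (simp add: d_def sum.If_cases)
    also have "\<dots> \<le> (\<Sum>v\<in>F n. (cmod (a v))\<^sup>2 / S n)"
      using Spos[of n] F by (intro sum_mono2) auto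
    also have "\<dots> = 1" using Spos[of n] by (simp add: S_def flip: sum_divide_distrib)
    finally show ?thesis .
  qed
  have d1: "d n v \<le> 1" for n v using d_mass[of "{v}" n] by simp
  have geo: "summable (\<lambda>n. (1/2 :: real) ^ n)" by simp
  have sm: "summable (\<lambda>n. (1/2) ^ n * d n v)" for v
    using d0 d1 by (intro summable_comparison_test[OF _ geo]) (auto intro!: exI[of _ 0] mult_left_le)
  define w where "w v = (\<Sum>n. (1/2) ^ n * d n v)" for v
  have w_ge: "(1/2) ^ n * d n v \<le> w v" for n v
    unfolding w_def using d0 sum_le_suminf[OF sm[of v], of "{n}"] by simp
  have w0: "0 \<le> w v" for v
    unfolding w_def using d0 sm by (intro suminf_nonneg) auto
  have w_sum: "(\<Sum>v\<in>G. w v) \<le> 2" if "finite G" for G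
  proof -
    have "(\<Sum>v\<in>G. w v) = (\<Sum>n. \<Sum>v\<in>G. (1/2) ^ n * d n v)"
      unfolding w_def using sm by (intro suminf_sum[symmetric])
    also have "\<dots> \<le> (\<Sum>n. (1/2) ^ n)"
    proof (rule suminf_le[OF _ summable_sum[OF sm] geo])
      show "(\<Sum>v\<in>G. (1/2) ^ n * d n v) \<le> (1/2) ^ n" for n
        using d_mass[OF that, of n] by (simp flip: sum_distrib_left)
    qed
    also have "\<dots> = 2" by (simp add: suminf_geometric)
    finally show ?thesis .
  qed
  define h where "h v = (if v \<in> U then complex_of_real (sqrt (w v)) else 0)" for v
  have "w summable_on UNIV"
    using w0 w_sum by (intro nonneg_bdd_above_summable_on bdd_aboveI2[where M = 2]) auto
  then have "w summable_on U" by (rule summable_on_subset_banach) simp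
  then have "(\<lambda>v. (cmod (h v))\<^sup>2) summable_on U"
    by (rule summable_on_cong[THEN iffD1, rotated]) (simp add: h_def w0)
  then have "h \<in> l2 U"
    by (simp add: l2_def h_def)
  from summable_on_iff_abs_summable_on_complex[THEN iffD1, OF pair[OF this]]
  have "(\<lambda>v. norm (h v * a v)) summable_on U" .
  then have bound: "(\<Sum>v\<in>F n. norm (h v * a v)) \<le> (\<Sum>\<^sub>\<infinity>v\<in>U. norm (h v * a v))" for n
    using F by (intro finite_sum_le_infsum) auto
  have "sqrt 2 ^ n \<le> (\<Sum>v\<in>F n. norm (h v * a v))" for n
  proof -
    have "2 ^ n \<le> (1/2) ^ n * S n"
    proof -
      have "(2::real) ^ n = (1/2) ^ n * 4 ^ n" by (simp flip: power_mult_distrib)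
      then show ?thesis using S4[of n] by simp
    qed
    then have "sqrt 2 ^ n \<le> sqrt ((1/2) ^ n * S n)"
      by (simp flip: real_sqrt_power)
    also have "\<dots> = sqrt ((1/2) ^ n / S n) * S n"
      using Spos[of n] by (simp add: real_sqrt_mult real_sqrt_divide real_div_sqrt field_simps)
    also have "\<dots> = (\<Sum>v\<in>F n. sqrt ((1/2) ^ n / S n) * (cmod (a v))\<^sup>2)"
      by (simp add: S_def sum_distrib_left)
    also have "\<dots> \<le> (\<Sum>v\<in>F n. norm (h v * a v))"
    proof (rule sum_mono)
      fix v assume v: "v \<in> F n"
      have "sqrt ((1/2) ^ n / S n) * cmod (a v) = sqrt ((1/2) ^ n * d n v)"
        using v by (simp add: d_def real_sqrt_mult real_sqrt_divide)
      also have "\<dots> \<le> sqrt (w v)" using w_ge by (rule real_sqrt_le_mono)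
      also have "\<dots> = cmod (h v)" using v F w0 by (auto simp: h_def)
      finally show "sqrt ((1/2) ^ n / S n) * (cmod (a v))\<^sup>2 \<le> norm (h v * a v)"
        by (auto simp: norm_mult power2_eq_square mult.assoc[symmetric] intro!: mult_right_mono)
    qed
    finally show ?thesis .
  qed
  moreover obtain n where "(\<Sum>\<^sub>\<infinity>v\<in>U. norm (h v * a v)) < sqrt 2 ^ n"
    using real_arch_pow[of "sqrt 2"] by auto
  ultimately show False using bound[of n] by (meson not_le order.trans)
qed

lemma l2_linear_combination:
  assumes h: "h \<in> l2 S" and k: "k \<in> l2 S"
  shows "(\<lambda>v. \<alpha> * h v + \<beta> * k v) \<in> l2 S"
proof -
  have "(\<lambda>v. 2 * ((cmod \<alpha>)\<^sup>2 * (cmod (h v))\<^sup>2) + 2 * ((cmod \<beta>)\<^sup>2 * (cmod (k v))\<^sup>2)) summable_on S"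
    using h k by (intro summable_on_add summable_on_cmult_right) (auto simp: l2_def)
  then have "(\<lambda>v. (cmod (\<alpha> * h v + \<beta> * k v))\<^sup>2) summable_on S"
  proof (rule summable_on_comparison_test)
    fix v
    have "(cmod (\<alpha> * h v + \<beta> * k v))\<^sup>2 \<le> (cmod (\<alpha> * h v) + cmod (\<beta> * k v))\<^sup>2"
      by (intro power_mono norm_triangle_ineq) simp
    also have "\<dots> \<le> 2 * ((cmod \<alpha>)\<^sup>2 * (cmod (h v))\<^sup>2) + 2 * ((cmod \<beta>)\<^sup>2 * (cmod (k v))\<^sup>2)"
      using sum_squares_bound[of "cmod (\<alpha> * h v)" "cmod (\<beta> * k v)"]
      by (simp add: power2_sum norm_mult power_mult_distrib)
    finally show "(cmod (\<alpha> * h v + \<beta> * k v))\<^sup>2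
      \<le> 2 * ((cmod \<alpha>)\<^sup>2 * (cmod (h v))\<^sup>2) + 2 * ((cmod \<beta>)\<^sup>2 * (cmod (k v))\<^sup>2)" .
  qed simp
  then show ?thesis using h k by (simp add: l2_def)
qed

lemma l2_norm_on_support:
  assumes "h \<in> l2 U"
  shows "l2_norm h = sqrt (\<Sum>\<^sub>\<infinity>v\<in>U. (cmod (h v))\<^sup>2)"
proof -
  have "(\<Sum>\<^sub>\<infinity>v. (cmod (h v))\<^sup>2) = (\<Sum>\<^sub>\<infinity>v\<in>U. (cmod (h v))\<^sup>2)"
    using assms by (intro infsum_cong_neutral) (auto simp: l2_def)
  then show ?thesis by (simp add: l2_norm_def)
qed

lemma l2_norm_scale: "l2_norm (\<lambda>v. c * f v) = cmod c * l2_norm f"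
  by (simp add: l2_norm_def norm_mult power_mult_distrib infsum_cmult_right' real_sqrt_mult)

lemma join_compl_scale:
  assumes "f \<in> join_compl V E u b"
  shows "(\<lambda>v. c * f v) \<in> join_compl V E u b"
proof -
  have "f \<in> l2 V" using assms by (simp add: join_compl_def l2_ominus_def)
  from l2_linear_combination[OF this this, of c 0] have "(\<lambda>v. c * f v) \<in> l2 V" by simp
  moreover have "l2_inner (\<lambda>v. c * f v) h = c * l2_inner f h" for h
    by (simp add: l2_inner_def mult.assoc infsum_cmult_right')
  ultimately show ?thesis using assms by (simp add: join_compl_def l2_ominus_def)
qed

section \<open>The resolvent of the diagonal operator\<close>

lemma Gamma_set_gap:
  assumes "\<mu> \<in> Gamma_set V E u b lam"
  obtains c where "0 < c" and "\<And>v. v \<in> supp_set V E u b \<Longrightarrow> c \<le> cmod (lam v - \<mu>)"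
proof -
  have "0 < (INF v\<in>supp_set V E u b. ereal (cmod (\<mu> - lam v)))"
    using assms by (simp add: Gamma_set_def)
  then obtain c where c: "0 < ereal c" "ereal c < (INF v\<in>supp_set V E u b. ereal (cmod (\<mu> - lam v)))"
    using ereal_dense2 by blast
  have "c \<le> cmod (lam v - \<mu>)" if "v \<in> supp_set V E u b" for v
  proof -
    have "ereal c < ereal (cmod (\<mu> - lam v))"
      using c(2) INF_lower[OF that] by (rule less_le_trans)
    then show ?thesis by (simp add: norm_minus_commute)
  qed
  with c(1) show thesis using that by simp
qed

lemma Gamma_set_neq: "\<mu> \<in> Gamma_set V E u b lam \<Longrightarrow> v \<in> supp_set V E u b \<Longrightarrow> lam v \<noteq> \<mu>"
  by (erule Gamma_set_gap) fastforce

lemma Domain_diag_op: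
  "Domain (diag_op V E u b lam) =
     {h \<in> l2 (supp_set V E u b). (\<lambda>v. lam v * h v) \<in> l2 (supp_set V E u b)}"
  by (auto simp: diag_op_def join_space_def)

lemma Domain_oslash_op:
  "Domain (oslash_op V E u b f g) =
     {h \<in> l2 (supp_set V E u b). (\<lambda>v. h v * cnj (g v)) summable_on supp_set V E u b}"
  by (auto simp: oslash_op_def join_space_def)

lemma resolvent_mem_Domain_diag_op:
  assumes \<mu>: "\<mu> \<in> Gamma_set V E u b lam" and k: "k \<in> l2 (supp_set V E u b)"
  shows "(\<lambda>v. k v / (lam v - \<mu>)) \<in> Domain (diag_op V E u b lam)"
proof -
  let ?U = "supp_set V E u b" and ?h = "\<lambda>v. k v / (lam v - \<mu>)"
  obtain c where c: "0 < c" "\<And>v. v \<in> ?U \<Longrightarrow> c \<le> cmod (lam v - \<mu>)"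
    using \<mu> by (rule Gamma_set_gap) blast
  have "(\<lambda>v. 1 / c\<^sup>2 * (cmod (k v))\<^sup>2) summable_on ?U"
    using k by (intro summable_on_cmult_right) (simp add: l2_def)
  then have "(\<lambda>v. (cmod (?h v))\<^sup>2) summable_on ?U"
  proof (rule summable_on_comparison_test)
    fix v assume "v \<in> ?U"
    then have "(cmod (k v))\<^sup>2 / (cmod (lam v - \<mu>))\<^sup>2 \<le> (cmod (k v))\<^sup>2 / c\<^sup>2"
      using c by (intro divide_left_mono power_mono mult_pos_pos zero_less_power)
        (auto simp: Gamma_set_neq[OF \<mu>])
    then show "(cmod (?h v))\<^sup>2 \<le> 1 / c\<^sup>2 * (cmod (k v))\<^sup>2"
      by (simp add: norm_divide power_divide)
  qed simp
  then have h: "?h \<in> l2 ?U" using k by (simp add: l2_def)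
  have "lam v * ?h v = 1 * k v + \<mu> * ?h v" for v
  proof (cases "v \<in> ?U")
    case True
    then show ?thesis using Gamma_set_neq[OF \<mu>] by (simp add: field_simps)
  next
    case False
    then show ?thesis using k by (simp add: l2_def)
  qed
  with l2_linear_combination[OF k h, of 1 \<mu>] h show ?thesis by (simp add: Domain_diag_op)
qed

text \<open>For \<open>\<mu>\<close> at positive distance from the weights, \<open>D - \<mu>\<close> maps its domain bijectively onto
  \<open>\<ell>\<^sup>2(U)\<close>, the inverse being division by \<open>lam - \<mu>\<close>. Off \<open>U\<close> this is consistent whatever the
  value of \<open>lam\<close> there, since the vectors vanish.\<close>

lemma op_minus_scalar_diag_op:
  assumes \<mu>: "\<mu> \<in> Gamma_set V E u b lam"
  shows "op_minus_scalar (diag_op V E u b lam) \<mu> =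
    {(\<lambda>v. k v / (lam v - \<mu>), k) | k. k \<in> l2 (supp_set V E u b)}" (is "?L = ?R")
proof
  let ?U = "supp_set V E u b"
  show "?L \<subseteq> ?R"
  proof
    fix p assume "p \<in> ?L"
    then obtain h where h: "h \<in> l2 ?U" "(\<lambda>v. lam v * h v) \<in> l2 ?U"
      and p: "p = (h, \<lambda>v. lam v * h v - \<mu> * h v)"
      by (auto simp: op_minus_scalar_def diag_op_def join_space_def)
    have "h v = (lam v * h v - \<mu> * h v) / (lam v - \<mu>)" for v
    proof (cases "v \<in> ?U")
      case True
      then show ?thesis using Gamma_set_neq[OF \<mu>] by (simp add: field_simps)
    next
      case False
      then show ?thesis using h by (simp add: l2_def)
    qed
    then show "p \<in> ?R"
      using l2_linear_combination[OF h(2,1), of 1 "- \<mu>"] p by auto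
  qed
  show "?R \<subseteq> ?L"
  proof
    fix p assume "p \<in> ?R"
    then obtain k where k: "k \<in> l2 ?U" and p: "p = (\<lambda>v. k v / (lam v - \<mu>), k)" by auto
    let ?h = "\<lambda>v. k v / (lam v - \<mu>)"
    have k_eq: "k = (\<lambda>v. lam v * ?h v - \<mu> * ?h v)"
    proof
      fix v
      show "k v = lam v * ?h v - \<mu> * ?h v"
      proof (cases "v \<in> ?U")
        case True
        then show ?thesis
          using Gamma_set_neq[OF \<mu>] by (simp flip: diff_divide_distrib left_diff_distrib)
      next
        case False
        then show ?thesis using k by (simp add: l2_def)
      qed
    qed
    have "(?h, \<lambda>v. lam v * ?h v) \<in> diag_op V E u b lam"
      using resolvent_mem_Domain_diag_op[OF \<mu> k] by (auto simp: diag_op_def)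
    then have "(?h, \<lambda>v. lam v * ?h v - \<mu> * ?h v) \<in> ?L"
      unfolding op_minus_scalar_def
      by (intro CollectI exI[of _ ?h] exI[of _ "\<lambda>v. lam v * ?h v"] conjI refl)
    then show "p \<in> ?L" by (simp only: p flip: k_eq)
  qed
qed

text \<open>So \<open>(f \<oslash> g)(D - \<mu>)\<^sup>-\<^sup>1\<close> is again of the form \<open>f \<oslash> g'\<close>, with \<open>g' = g / cnj (lam - \<mu>)\<close>:
  all questions about it concern pairings of \<open>\<ell>\<^sup>2(U)\<close> with a single sequence.\<close>

lemma L_op_eq:
  assumes \<mu>: "\<mu> \<in> Gamma_set V E u b lam"
  shows "L_op V E u b lam f g \<mu> =
    {(k, \<lambda>v. (\<Sum>\<^sub>\<infinity>w\<in>supp_set V E u b. k w * (cnj (g w) / (lam w - \<mu>))) * f v) | k.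
       k \<in> l2 (supp_set V E u b) \<and>
       (\<lambda>w. k w * (cnj (g w) / (lam w - \<mu>))) summable_on supp_set V E u b}"
proof -
  have "(\<lambda>v. k v / (lam v - \<mu>)) \<in> l2 (supp_set V E u b)" if "k \<in> l2 (supp_set V E u b)" for k
    using resolvent_mem_Domain_diag_op[OF \<mu> that] by (simp add: Domain_diag_op)
  then show ?thesis
    unfolding L_op_def op_minus_scalar_diag_op[OF \<mu>] oslash_op_def join_space_def
    by (fastforce simp: relcomp_unfold)
qed

section \<open>The compatibility conditions\<close>

text \<open>Both conditions are instances of one argument: split \<open>h * cnj g\<close> as \<open>(h * w) * (cnj g / w)\<close>
  with a positive weight \<open>w\<close> of the size of the operator's own growth, so that \<open>h * w\<close> is square
  summable for \<open>h\<close> in the domain of \<open>D\<close> while the compatibility condition makes \<open>g / w\<close> square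
  summable. For I the weight is \<open>|lam - \<mu>|\<close>, for II it is \<open>sqrt (|lam|\<^sup>2 + 1)\<close>.\<close>

lemma Domain_diag_op_subset_if_compat:
  assumes "compat_I V E u b lam g \<or> compat_II V E u b lam g"
  shows "Domain (diag_op V E u b lam) \<subseteq> Domain (oslash_op V E u b f g)"
proof
  let ?U = "supp_set V E u b"
  fix h assume "h \<in> Domain (diag_op V E u b lam)"
  then have h: "h \<in> l2 ?U" "(\<lambda>v. lam v * h v) \<in> l2 ?U" by (auto simp: Domain_diag_op)
  have "\<exists>w. (\<lambda>v. (cmod (h v * complex_of_real (w v)))\<^sup>2) summable_on ?U \<and>
      (\<lambda>v. (cmod (cnj (g v) / complex_of_real (w v)))\<^sup>2) summable_on ?U \<and> (\<forall>v\<in>?U. w v \<noteq> 0)"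
    using assms
  proof
    assume "compat_I V E u b lam g"
    then obtain \<mu> where \<mu>: "\<mu> \<in> Gamma_set V E u b lam"
      and g: "(\<lambda>v. (cmod (g v))\<^sup>2 / (cmod (lam v - \<mu>))\<^sup>2) summable_on ?U"
      by (auto simp: compat_I_def)
    have "(\<lambda>v. (cmod (h v * complex_of_real (cmod (lam v - \<mu>))))\<^sup>2) summable_on ?U"
      using l2_linear_combination[OF h(2,1), of 1 "- \<mu>"]
      by (simp add: l2_def norm_mult flip: left_diff_distrib) (simp add: mult.commute)
    then show ?thesis
      using g Gamma_set_neq[OF \<mu>]
      by (intro exI[of _ "\<lambda>v. cmod (lam v - \<mu>)"]) (auto simp: norm_divide power_divide)
  next
    assume "compat_II V E u b lam g"
    then have g: "(\<lambda>v. (cmod (g v))\<^sup>2 / ((cmod (lam v))\<^sup>2 + 1)) summable_on ?U"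
      by (simp add: compat_II_def)
    have "(\<lambda>v. (cmod (lam v * h v))\<^sup>2 + (cmod (h v))\<^sup>2) summable_on ?U"
      using h by (intro summable_on_add) (auto simp: l2_def)
    then have "(\<lambda>v. (cmod (h v * complex_of_real (sqrt ((cmod (lam v))\<^sup>2 + 1))))\<^sup>2) summable_on ?U"
      by (simp add: norm_mult power_mult_distrib algebra_simps)
    moreover have "sqrt ((cmod (lam v))\<^sup>2 + 1) \<noteq> 0" for v
      by (smt (verit) real_sqrt_eq_zero_cancel_iff zero_le_power2)
    ultimately show ?thesis
      using g by (intro exI[of _ "\<lambda>v. sqrt ((cmod (lam v))\<^sup>2 + 1)"])
        (auto simp: norm_divide power_divide)
  qed
  then obtain w where w: "(\<lambda>v. (cmod (h v * complex_of_real (w v)))\<^sup>2) summable_on ?U"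
      "(\<lambda>v. (cmod (cnj (g v) / complex_of_real (w v)))\<^sup>2) summable_on ?U"
    and w0: "\<forall>v\<in>?U. w v \<noteq> 0" by blast
  have "(\<lambda>v. h v * complex_of_real (w v) * (cnj (g v) / complex_of_real (w v))) summable_on ?U"
    using w by (rule abs_summable_summable[OF summable_mult_of_squares])
  then have "(\<lambda>v. h v * cnj (g v)) summable_on ?U"
    by (rule summable_on_cong[THEN iffD1, rotated]) (use w0 in auto)
  then show "h \<in> Domain (oslash_op V E u b f g)" using h by (simp add: Domain_oslash_op)
qed

lemma pairing_with_resolvent_weight:
  "(\<forall>k\<in>l2 U. (\<lambda>v. k v * (cnj (g v) / (lam v - \<mu>))) summable_on U) \<longleftrightarrow>
   (\<lambda>v. (cmod (g v))\<^sup>2 / (cmod (lam v - \<mu>))\<^sup>2) summable_on U"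
proof -
  have eq: "(cmod (cnj (g v) / (lam v - \<mu>)))\<^sup>2 = (cmod (g v))\<^sup>2 / (cmod (lam v - \<mu>))\<^sup>2" for v
    by (simp add: norm_divide power_divide)
  show ?thesis
    using square_summable_if_all_pairings_summable[of U "\<lambda>v. cnj (g v) / (lam v - \<mu>)"]
      abs_summable_summable[OF summable_mult_of_squares[of _ U "\<lambda>v. cnj (g v) / (lam v - \<mu>)"]]
    by (auto simp: eq l2_def)
qed

text \<open>The resolvent at \<open>\<mu>\<close> carries every \<open>k\<close> in \<open>\<ell>\<^sup>2(U)\<close> into the domain of \<open>D\<close>, so the inclusion makes
  every pairing of \<open>k\<close> with \<open>cnj g / (lam - \<mu>)\<close> converge. This works at each \<open>\<mu>\<close> in \<open>Gamma_set\<close>,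
  which is why condition I, once true at some point, is true at all of them.\<close>

lemma summable_if_Domain_diag_op_subset:
  assumes sub: "Domain (diag_op V E u b lam) \<subseteq> Domain (oslash_op V E u b f g)"
    and \<mu>: "\<mu> \<in> Gamma_set V E u b lam"
  shows "(\<lambda>v. (cmod (g v))\<^sup>2 / (cmod (lam v - \<mu>))\<^sup>2) summable_on supp_set V E u b"
  unfolding pairing_with_resolvent_weight[symmetric]
  using sub resolvent_mem_Domain_diag_op[OF \<mu>] by (fastforce simp: Domain_oslash_op)

lemma hilbert_transform_defined_iff:
  "(\<forall>h\<in>join_space V E u b. hilbert_transform_defined V E u b lam g h \<mu>) \<longleftrightarrow>
   (\<lambda>v. (cmod (g v))\<^sup>2 / (cmod (lam v - \<mu>))\<^sup>2) summable_on supp_set V E u b"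
proof -
  have "h v * cnj (g v) / (\<mu> - lam v) = - (h v * (cnj (g v) / (lam v - \<mu>)))" for h v
    by (simp add: minus_divide_right)
  then show ?thesis
    unfolding pairing_with_resolvent_weight[symmetric] hilbert_transform_defined_def join_space_def
    by (simp only: summable_on_uminus)
qed

text \<open>Being everywhere defined already forces square summability of \<open>g / (lam - \<mu>)\<close>; conversely
  Cauchy--Schwarz bounds the coefficient of \<open>f\<close>, and with it the operator.\<close>

lemma bounded_L_op_iff:
  assumes f: "f \<in> join_compl V E u b" and \<mu>: "\<mu> \<in> Gamma_set V E u b lam"
  shows "bounded_linear_transformation (L_op V E u b lam f g \<mu>)
      (join_space V E u b) (join_compl V E u b) \<longleftrightarrow>
    (\<lambda>v. (cmod (g v))\<^sup>2 / (cmod (lam v - \<mu>))\<^sup>2) summable_on supp_set V E u b"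
proof
  let ?U = "supp_set V E u b"
  assume "bounded_linear_transformation (L_op V E u b lam f g \<mu>)
      (join_space V E u b) (join_compl V E u b)"
  then have "Domain (L_op V E u b lam f g \<mu>) = l2 ?U"
    by (simp add: bounded_linear_transformation_def join_space_def)
  then show "(\<lambda>v. (cmod (g v))\<^sup>2 / (cmod (lam v - \<mu>))\<^sup>2) summable_on ?U"
    unfolding pairing_with_resolvent_weight[symmetric] L_op_eq[OF \<mu>] by blast
next
  let ?U = "supp_set V E u b"
  define a where "a v = cnj (g v) / (lam v - \<mu>)" for v
  define \<phi> where "\<phi> k = (\<Sum>\<^sub>\<infinity>w\<in>?U. k w * a w)" for k
  assume g: "(\<lambda>v. (cmod (g v))\<^sup>2 / (cmod (lam v - \<mu>))\<^sup>2) summable_on ?U"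
  then have a: "(\<lambda>v. (cmod (a v))\<^sup>2) summable_on ?U"
    by (simp add: a_def norm_divide power_divide)
  have pair: "(\<lambda>w. k w * a w) summable_on ?U" if "k \<in> l2 ?U" for k
    using that a by (intro abs_summable_summable[OF summable_mult_of_squares]) (simp_all add: l2_def)
  have L: "L_op V E u b lam f g \<mu> = {(k, \<lambda>v. \<phi> k * f v) | k. k \<in> l2 ?U}"
    using pair unfolding L_op_eq[OF \<mu>] a_def \<phi>_def by auto
  have lin: "\<phi> (\<lambda>v. \<alpha> * h v + \<beta> * k v) = \<alpha> * \<phi> h + \<beta> * \<phi> k"
    if "h \<in> l2 ?U" "k \<in> l2 ?U" for h k \<alpha> \<beta>
  proof -
    have "\<phi> (\<lambda>v. \<alpha> * h v + \<beta> * k v) = (\<Sum>\<^sub>\<infinity>w\<in>?U. \<alpha> * (h w * a w) + \<beta> * (k w * a w))"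
      by (simp add: \<phi>_def algebra_simps)
    also have "\<dots> = \<alpha> * \<phi> h + \<beta> * \<phi> k"
      using that by (simp add: \<phi>_def infsum_add summable_on_cmult_right pair infsum_cmult_right')
    finally show ?thesis .
  qed
  have bd: "l2_norm (\<lambda>v. \<phi> k * f v)
      \<le> (sqrt (\<Sum>\<^sub>\<infinity>v\<in>?U. (cmod (a v))\<^sup>2) * l2_norm f) * l2_norm k" if k: "k \<in> l2 ?U" for k
  proof -
    have "cmod (\<phi> k) \<le> l2_norm k * sqrt (\<Sum>\<^sub>\<infinity>v\<in>?U. (cmod (a v))\<^sup>2)"
      unfolding \<phi>_def l2_norm_on_support[OF k]
      using k a by (intro norm_infsum_mult_le) (simp_all add: l2_def)
    moreover have "0 \<le> l2_norm f" by (simp add: l2_norm_def infsum_nonneg)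
    ultimately have "cmod (\<phi> k) * l2_norm f
        \<le> l2_norm k * sqrt (\<Sum>\<^sub>\<infinity>v\<in>?U. (cmod (a v))\<^sup>2) * l2_norm f"
      by (rule mult_right_mono)
    then show ?thesis by (simp add: l2_norm_scale mult_ac)
  qed
  have "(\<lambda>v. \<alpha> * h v + \<beta> * h' v, \<lambda>v. \<alpha> * k v + \<beta> * k' v) \<in> L_op V E u b lam f g \<mu>"
    if "(h, k) \<in> L_op V E u b lam f g \<mu>" "(h', k') \<in> L_op V E u b lam f g \<mu>" for h k h' k' \<alpha> \<beta>
  proof -
    have h: "h \<in> l2 ?U" "h' \<in> l2 ?U" and k: "k = (\<lambda>v. \<phi> h * f v)" "k' = (\<lambda>v. \<phi> h' * f v)"
      using that by (auto simp: L)
    have "(\<lambda>v. \<alpha> * k v + \<beta> * k' v) = (\<lambda>v. \<phi> (\<lambda>v. \<alpha> * h v + \<beta> * h' v) * f v)"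
      by (simp add: lin[OF h] k algebra_simps)
    then show ?thesis using l2_linear_combination[OF h] unfolding L by blast
  qed
  moreover have "single_valued (L_op V E u b lam f g \<mu>)" by (auto simp: single_valued_def L)
  moreover have "Domain (L_op V E u b lam f g \<mu>) = join_space V E u b"
    by (auto simp: L join_space_def)
  moreover have "Range (L_op V E u b lam f g \<mu>) \<subseteq> join_compl V E u b"
    using join_compl_scale[OF f] by (auto simp: L)
  moreover have "\<exists>C. \<forall>h k. (h, k) \<in> L_op V E u b lam f g \<mu> \<longrightarrow> l2_norm k \<le> C * l2_norm h"
    using bd by (auto simp: L)
  ultimately show "bounded_linear_transformation (L_op V E u b lam f g \<mu>)
      (join_space V E u b) (join_compl V E u b)"
    unfolding bounded_linear_transformation_def by blast
qed

theorem proposition4p7: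
  fixes V :: "'a set" and E :: "('a \<times> 'a) set" and u b :: 'a
    and lam f g :: "'a \<Rightarrow> complex"
    and W :: "'a l2_op"
  assumes "rooted_directed_tree V E"
    and "u \<in> V" and "b \<in> V"
    and "f \<in> join_compl V E u b" and "f \<noteq> (\<lambda>_. 0)"
    and "W = rank_one_ext V E u b lam f g"
  shows "(compat_I V E u b lam g \<or> compat_II V E u b lam g \<longrightarrow>
            Domain (diag_op V E u b lam) \<subseteq> Domain (oslash_op V E u b f g)) \<and>
         (Gamma_set V E u b lam \<noteq> {} \<longrightarrow>
            (Domain (diag_op V E u b lam) \<subseteq> Domain (oslash_op V E u b f g) \<longleftrightarrow>
               compat_I V E u b lam g) \<and>
            (compat_I V E u b lam g \<longleftrightarrow>
               (\<forall>\<mu>\<in>Gamma_set V E u b lam. \<forall>h\<in>join_space V E u b.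
                  hilbert_transform_defined V E u b lam g h \<mu>)) \<and>
            ((\<forall>\<mu>\<in>Gamma_set V E u b lam. \<forall>h\<in>join_space V E u b.
                  hilbert_transform_defined V E u b lam g h \<mu>) \<longleftrightarrow>
               (\<forall>\<mu>\<in>Gamma_set V E u b lam.
                  bounded_linear_transformation (L_op V E u b lam f g \<mu>)
                    (join_space V E u b) (join_compl V E u b))))"
proof -
  \<comment> \<open>The pivot: square summability of \<open>g / (lam - \<mu>)\<close>. The inclusion of domains gives it at every
    \<open>\<mu>\<close> of \<open>?\<Gamma>\<close> and follows from it at a single one, so for nonempty \<open>?\<Gamma>\<close> each of the four
    statements says that it holds throughout \<open>?\<Gamma>\<close>.\<close>
  let ?S = "\<lambda>\<mu>. (\<lambda>v. (cmod (g v))\<^sup>2 / (cmod (lam v - \<mu>))\<^sup>2) summable_on supp_set V E u b"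
  let ?\<Gamma> = "Gamma_set V E u b lam"
  have I: "compat_I V E u b lam g \<longleftrightarrow> (\<exists>\<mu>\<in>?\<Gamma>. ?S \<mu>)" by (simp add: compat_I_def)
  have from_I: "compat_I V E u b lam g \<or> compat_II V E u b lam g \<longrightarrow>
      Domain (diag_op V E u b lam) \<subseteq> Domain (oslash_op V E u b f g)"
    by (intro impI Domain_diag_op_subset_if_compat)
  have all: "Domain (diag_op V E u b lam) \<subseteq> Domain (oslash_op V E u b f g) \<Longrightarrow> \<forall>\<mu>\<in>?\<Gamma>. ?S \<mu>"
    by (intro ballI summable_if_Domain_diag_op_subset)
  show ?thesis
    using from_I all bounded_L_op_iff[OF assms(4)] I
    unfolding hilbert_transform_defined_iff by blast
qed

end
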